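(* There exist a positive integer $N$, partitions $P,Q,R,S$ of $N$, and an outline box $O$ associated to $(P,Q,R,S)$ such that $O$ is not the reduction modulo $(P,Q,R,S)$ of any latin cube of order $N$. (That is, not every outline box is the reduction of a latin cube.)
   Context: A latin cube of order $N$ is an $N\times N\times N$ array $C$ with entries $C(j_1,j_2,j_3)$ from the symbol set $[N]=\{1,\dots,N\}$ such that any two cells whose coordinates differ in exactly one position contain different symbols. A partition of $N$ is a non-increasing sequence of positive integers summing to $N$. Given partitions $P=(p_1,\dots,p_u)$, $Q=(q_1,\dots,q_v)$, $R=(r_1,\dots,r_w)$, $S=(s_1,\dots,s_t)$ of $N$, an outline box associated to $(P,Q,R,S)$ is a $u\times v\times w$ array $O$ of multisets with elements from $[t]$ such that: (1) symbol $l\in[t]$ occurs $N^2 s_l$ times in $O$ in total; (2) the cell $O(i,j,k)$ has exactly $p_iq_jr_k$ elements counted with multiplicity; (3) symbol $l$ occurs $p_iq_js_l$ times in the line $(i,j,[w])$; (4) symbol $l$ occurs $p_ir_ks_l$ times in the line $(i,[v],k)$; (5) symbol $l$ occurs $q_jr_ks_l$ times in the line $([u],j,k)$. The reduction modulo $(P,Q,R,S)$ of a latin cube $C$ of order $N$ is the $u\times v\times w$ array of multisets obtained by amalgamating, for each $i\in[u]$, the first-coordinate layers with indices in $(p_1+\dots+p_{i-1})+[p_i]$, for each $j\in[v]$ the second-coordinate layers with indices in $(q_1+\dots+q_{j-1})+[q_j]$, for each $k\in[w]$ the third-coordinate layers with indices in $(r_1+\dots+r_{k-1})+[r_k]$,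 and mapping every symbol in $(s_1+\dots+s_{l-1})+[s_l]$ to $l$; i.e. cell $(i,j,k)$ of the reduction is the multiset of images of the symbols of $C$ in the corresponding block of $p_iq_jr_k$ cells. Here $b+[a]=\{b+1,\dots,b+a\}$. *)

theory Defs
  imports "HOL-Library.Multiset"
begin

text \<open>
  Rows, columns, files, symbols and the members of a partition are all numbered from 1, so
  \<open>[n]\<close> is \<open>{1..n}\<close>. Arrays are curried functions on \<open>nat\<close>; only their values at indices in
  the stated ranges matter.
\<close>

definition latin_cube :: "nat \<Rightarrow> (nat \<Rightarrow> nat \<Rightarrow> nat \<Rightarrow> nat) \<Rightarrow> bool" where
  "latin_cube N C \<longleftrightarrow>
     (\<forall>a\<in>{1..N}. \<forall>b\<in>{1..N}. \<forall>c\<in>{1..N}. C a b c \<in> {1..N}) \<and>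
     (\<forall>b\<in>{1..N}. \<forall>c\<in>{1..N}. inj_on (\<lambda>a. C a b c) {1..N}) \<and>
     (\<forall>a\<in>{1..N}. \<forall>c\<in>{1..N}. inj_on (\<lambda>b. C a b c) {1..N}) \<and>
     (\<forall>a\<in>{1..N}. \<forall>b\<in>{1..N}. inj_on (\<lambda>c. C a b c) {1..N})"

definition is_partition :: "nat \<Rightarrow> nat list \<Rightarrow> bool" where
  "is_partition N P \<longleftrightarrow> sorted_wrt (\<ge>) P \<and> (\<forall>p\<in>set P. 0 < p) \<and> sum_list P = N"

definition part :: "nat list \<Rightarrow> nat \<Rightarrow> nat" where
  "part P i = P ! (i - 1)"

text \<open>The set \<open>(p\<^sub>1 + \<dots> + p\<^bsub>i-1\<^esub>) + [p\<^sub>i]\<close>:\<close>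

definition block :: "nat list \<Rightarrow> nat \<Rightarrow> nat set" where
  "block P i = (let b = (\<Sum>m\<in>{1..<i}. part P m) in {b + 1..b + part P i})"

definition outline_box ::
  "nat \<Rightarrow> nat list \<Rightarrow> nat list \<Rightarrow> nat list \<Rightarrow> nat list
    \<Rightarrow> (nat \<Rightarrow> nat \<Rightarrow> nat \<Rightarrow> nat multiset) \<Rightarrow> bool" where
  "outline_box N P Q R S B \<longleftrightarrow>
     (let u = length P; v = length Q; w = length R; t = length S in
       (\<forall>i\<in>{1..u}. \<forall>j\<in>{1..v}. \<forall>k\<in>{1..w}. set_mset (B i j k) \<subseteq> {1..t}) \<and>
       (\<forall>l\<in>{1..t}. (\<Sum>i\<in>{1..u}. \<Sum>j\<in>{1..v}. \<Sum>k\<in>{1..w}. count (B i j k) l) = N\<^sup>2 * part S l) \<and>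
       (\<forall>i\<in>{1..u}. \<forall>j\<in>{1..v}. \<forall>k\<in>{1..w}. size (B i j k) = part P i * part Q j * part R k) \<and>
       (\<forall>i\<in>{1..u}. \<forall>j\<in>{1..v}. \<forall>l\<in>{1..t}.
          (\<Sum>k\<in>{1..w}. count (B i j k) l) = part P i * part Q j * part S l) \<and>
       (\<forall>i\<in>{1..u}. \<forall>k\<in>{1..w}. \<forall>l\<in>{1..t}.
          (\<Sum>j\<in>{1..v}. count (B i j k) l) = part P i * part R k * part S l) \<and>
       (\<forall>j\<in>{1..v}. \<forall>k\<in>{1..w}. \<forall>l\<in>{1..t}.
          (\<Sum>i\<in>{1..u}. count (B i j k) l) = part Q j * part R k * part S l))"

definition block_index :: "nat list \<Rightarrow> nat \<Rightarrow> nat" where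
  "block_index S x = (THE l. l \<in> {1..length S} \<and> x \<in> block S l)"

definition reduction ::
  "nat list \<Rightarrow> nat list \<Rightarrow> nat list \<Rightarrow> nat list \<Rightarrow> (nat \<Rightarrow> nat \<Rightarrow> nat \<Rightarrow> nat)
    \<Rightarrow> nat \<Rightarrow> nat \<Rightarrow> nat \<Rightarrow> nat multiset" where
  "reduction P Q R S C i j k =
     image_mset (\<lambda>(a, b, c). block_index S (C a b c))
       (mset_set (block P i \<times> block Q j \<times> block R k))"

definition is_reduction_of ::
  "nat list \<Rightarrow> nat list \<Rightarrow> nat list \<Rightarrow> nat list \<Rightarrow> (nat \<Rightarrow> nat \<Rightarrow> nat \<Rightarrow> nat multiset)
    \<Rightarrow> (nat \<Rightarrow> nat \<Rightarrow> nat \<Rightarrow> nat) \<Rightarrow> bool" where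
  "is_reduction_of P Q R S B C \<longleftrightarrow>
     (\<forall>i\<in>{1..length P}. \<forall>j\<in>{1..length Q}. \<forall>k\<in>{1..length R}. B i j k = reduction P Q R S C i j k)"

end

theory Submission
  imports Defs
begin

text \<open>
  Take \<open>N = 4\<close>, \<open>P = Q = S = (1,1,1,1)\<close> and \<open>R = (2,2)\<close>. An outline box is then a \<open>4 \<times> 4\<close> array
  of 2-subsets of \<open>{1..4}\<close>, with every symbol twice in each row and column, together with the array
  of complements. It is the reduction of a latin cube only if the array splits into two latin
  squares. Splitting it amounts to a proper 2-colouring of the graph on the triples (row, column,
  symbol of that cell) in which two triples are adjacent when they differ in exactly one
  coordinate. In the array below this graph contains the 7-cycle 111, 131, 134, 234, 214, 414, 411.
\<close>

definition odd_layer :: "nat \<Rightarrow> nat \<Rightarrow> nat set" where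
  "odd_layer i j =
     [[{1,3}, {2,3}, {1,4}, {2,4}],
      [{2,4}, {1,3}, {2,4}, {1,3}],
      [{2,3}, {1,4}, {1,3}, {2,4}],
      [{1,4}, {2,4}, {2,3}, {1,3}]] ! (i - 1) ! (j - 1)"

definition odd_box :: "nat \<Rightarrow> nat \<Rightarrow> nat \<Rightarrow> nat multiset" where
  "odd_box i j k = mset_set (if k = 1 then odd_layer i j else {1..4} - odd_layer i j)"

lemma atLeastAtMost_1_4: "{1..4::nat} = {1, 2, 3, 4}"
  by auto

lemma atLeastAtMost_1_2: "{1..2::nat} = {1, 2}"
  by auto

text \<open>Two out of four is its own complement, so these counts serve both layers of
  \<open>odd_box\<close>. They are verified by running through all 64 triples (\<open>i\<close>,
  \<open>j\<close>, \<open>l\<close>).\<close>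

lemma odd_layer_regular:
  assumes "i \<in> {1..4}" "j \<in> {1..4}" "l \<in> {1..4}"
  shows "odd_layer i j \<subseteq> {1..4}" "card (odd_layer i j) = 2"
    "(\<Sum>j\<in>{1..4}. of_bool (l \<in> odd_layer i j)) = (2::nat)"
    "(\<Sum>i\<in>{1..4}. of_bool (l \<in> odd_layer i j)) = (2::nat)"
  using assms unfolding atLeastAtMost_1_4
  by (elim insertE emptyE; hypsubst; simp add: odd_layer_def)+

lemma count_odd_box:
  assumes "i \<in> {1..4}" "j \<in> {1..4}" "l \<in> {1..4}"
  shows "count (odd_box i j 1) l = of_bool (l \<in> odd_layer i j)"
    "count (odd_box i j 2) l = 1 - of_bool (l \<in> odd_layer i j)"
proof -
  have "finite (odd_layer i j)"
    using odd_layer_regular(1)[OF assms] by (rule finite_subset) simp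
  then show "count (odd_box i j 1) l = of_bool (l \<in> odd_layer i j)"
    "count (odd_box i j 2) l = 1 - of_bool (l \<in> odd_layer i j)"
    using assms(3) by (simp_all add: odd_box_def)
qed

lemma outline_box_odd_box: "outline_box 4 [1,1,1,1] [1,1,1,1] [2,2] [1,1,1,1] odd_box"
proof -
  have part: "part [1,1,1,1] i = 1" if "i \<in> {1..4}" for i
    using that unfolding atLeastAtMost_1_4 by (auto simp: part_def)
  have part_2: "part [2,2] k = 2" if "k \<in> {1..2}" for k
    using that unfolding atLeastAtMost_1_2 by (auto simp: part_def)
  have symbols: "set_mset (odd_box i j k) \<subseteq> {1..4}" and size: "size (odd_box i j k) = 2"
    if "i \<in> {1..4}" "j \<in> {1..4}" for i j k
  proof -
    have sub: "odd_layer i j \<subseteq> {1..4}" and card: "card (odd_layer i j) = 2"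
      using odd_layer_regular[OF that, of 1] by simp_all
    then have "finite (odd_layer i j)"
      using finite_subset by blast
    then show "set_mset (odd_box i j k) \<subseteq> {1..4}" "size (odd_box i j k) = 2"
      using sub card by (auto simp: odd_box_def card_Diff_subset)
  qed
  have files: "(\<Sum>k\<in>{1..2}. count (odd_box i j k) l) = 1"
    if "i \<in> {1..4}" "j \<in> {1..4}" "l \<in> {1..4}" for i j l
    unfolding atLeastAtMost_1_2 using count_odd_box[OF that] by simp
  have columns: "(\<Sum>j\<in>{1..4}. count (odd_box i j k) l) = 2"
    if "i \<in> {1..4}" "k \<in> {1..2}" "l \<in> {1..4}" for i k l
  proof -
    have "k = 1 \<or> k = 2"
      using that(2) by auto
    \<comment> \<open>For \<open>k = 2\<close> the sum is 4 - 2. The subtraction on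
      \<open>nat\<close> may be taken out of the sum because each indicator is at most 1.\<close>
    then show ?thesis
      using that odd_layer_regular(3)[of i 1 l]
      by (auto simp: count_odd_box sum_subtractf_nat simp del: One_nat_def)
  qed
  have rows: "(\<Sum>i\<in>{1..4}. count (odd_box i j k) l) = 2"
    if "j \<in> {1..4}" "k \<in> {1..2}" "l \<in> {1..4}" for j k l
  proof -
    have "k = 1 \<or> k = 2"
      using that(2) by auto
    then show ?thesis
      using that odd_layer_regular(4)[of 1 j l]
      by (auto simp: count_odd_box sum_subtractf_nat simp del: One_nat_def)
  qed
  \<comment> \<open>Each of the 16 pairs (\<open>i\<close>, \<open>j\<close>) contributes 1, by
    \<open>files\<close>.\<close>
  have total: "(\<Sum>i\<in>{1..4}. \<Sum>j\<in>{1..4}. \<Sum>k\<in>{1..2}. count (odd_box i j k) l) = 4\<^sup>2"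
    if "l \<in> {1..4}" for l
    using that by (simp add: files del: One_nat_def)
  have lengths: "length [1,1,1,1::nat] = 4" "length [2,2::nat] = 2"
    by simp_all
  show ?thesis
    unfolding outline_box_def Let_def lengths
    by (intro conjI ballI; simp only: symbols size files columns rows total part part_2; simp)
qed

lemma part_replicate_1: "i \<in> {1..n} \<Longrightarrow> part (replicate n 1) i = 1"
  by (auto simp: part_def)

lemma block_replicate_1:
  assumes "i \<in> {1..n}"
  shows "block (replicate n 1) i = {i}"
proof -
  have "(\<Sum>m\<in>{1..<i}. part (replicate n 1) m) = (\<Sum>m\<in>{1..<i}. 1)"
    using assms by (intro sum.cong refl part_replicate_1) auto
  then show ?thesis
    using assms by (auto simp: block_def part_replicate_1 Let_def simp del: One_nat_def)
qed

lemma block_index_replicate_1: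
  assumes "x \<in> {1..n}"
  shows "block_index (replicate n 1) x = x"
  unfolding block_index_def
  by (rule the_equality) (use assms in \<open>auto simp: block_replicate_1 simp del: One_nat_def\<close>)

text \<open>With all parts of the other three partitions equal to 1, amalgamation merges only layers
  in the third direction and renames no symbol. Passing from multisets to sets loses nothing needed
  later, since the cells of \<open>odd_layer\<close> have no repeated symbol.\<close>

lemma set_mset_reduction_replicate_1:
  assumes "latin_cube N C" "i \<in> {1..N}" "j \<in> {1..N}" "block R k \<subseteq> {1..N}"
  shows "set_mset (reduction (replicate N 1) (replicate N 1) R (replicate N 1) C i j k)
           = C i j ` block R k"
proof -
  have "finite (block R k)"
    by (simp add: block_def Let_def)
  moreover have "block_index (replicate N 1) (C i j c) = C i j c" if "c \<in> block R k" for c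
    using assms that by (intro block_index_replicate_1) (auto simp: latin_cube_def)
  ultimately show ?thesis
    using assms(2,3) by (force simp: reduction_def block_replicate_1 simp del: One_nat_def)
qed

text \<open>Colour a triple by whether \<open>x\<close> or \<open>y\<close> holds its symbol. Two
  symbols of one cell get different colours, and so do two occurrences of a symbol in one row or
  column; an odd cycle admits no such colouring.\<close>

lemma odd_layer_not_separable:
  fixes x y :: "nat \<Rightarrow> nat \<Rightarrow> nat"
  assumes cells: "\<And>i j. i \<in> {1..4} \<Longrightarrow> j \<in> {1..4} \<Longrightarrow> {x i j, y i j} = odd_layer i j"
    and rows: "\<And>i. i \<in> {1..4} \<Longrightarrow> inj_on (x i) {1..4}" "\<And>i. i \<in> {1..4} \<Longrightarrow> inj_on (y i) {1..4}"
    and columns: "\<And>j. j \<in> {1..4} \<Longrightarrow> inj_on (\<lambda>i. x i j) {1..4}"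
      "\<And>j. j \<in> {1..4} \<Longrightarrow> inj_on (\<lambda>i. y i j) {1..4}"
  shows False
proof -
  have column_neq: "x i j \<noteq> x i' j" "y i j \<noteq> y i' j"
    if "i \<in> {1..4}" "i' \<in> {1..4}" "j \<in> {1..4}" "i \<noteq> i'" for i i' j
    using columns[OF that(3)] that(1,2,4) unfolding inj_on_def by blast+
  \<comment> \<open>These are the five cells that the 7-cycle visits; it passes through two symbols
    in cells (1,3) and (4,1).\<close>
  have "{x 1 1, y 1 1} = {1, 3}" "{x 1 3, y 1 3} = {1, 4}" "{x 2 3, y 2 3} = {2, 4}"
    "{x 2 1, y 2 1} = {2, 4}" "{x 4 1, y 4 1} = {1, 4}"
    by (simp_all add: cells odd_layer_def)
  moreover have "x 1 1 \<noteq> x 1 3" "y 1 1 \<noteq> y 1 3" "x 2 1 \<noteq> x 2 3" "y 2 1 \<noteq> y 2 3"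
    using rows[of 1] rows[of 2] by (simp_all add: inj_on_eq_iff)
  moreover have "x 1 3 \<noteq> x 2 3" "y 1 3 \<noteq> y 2 3" "x 2 1 \<noteq> x 4 1" "y 2 1 \<noteq> y 4 1"
    "x 1 1 \<noteq> x 4 1" "y 1 1 \<noteq> y 4 1"
    by (simp_all add: column_neq)
  \<comment> \<open>If \<open>x 1 1 = 1\<close>, then in turn \<open>x 1 3 = 4\<close>,
    \<open>y 2 3 = 4\<close>, \<open>x 2 1 = 4\<close>, \<open>y 4 1 = 4\<close> and
    \<open>x 4 1 = 1\<close>, which repeats a symbol in column 1. If \<open>y 1 1 = 1\<close>,
    exchange \<open>x\<close> and \<open>y\<close>.\<close>
  ultimately show False
    by (auto simp: doubleton_eq_iff)
qed

lemma odd_box_not_reduction: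
  assumes C: "latin_cube 4 C"
  shows "\<not> is_reduction_of [1,1,1,1] [1,1,1,1] [2,2] [1,1,1,1] odd_box C"
proof
  have replicate: "[1,1,1,1] = replicate 4 (1::nat)"
    by (simp add: numeral_eq_Suc)
  have block: "block [2,2] 1 = {1, 2}"
    by (auto simp: block_def part_def)
  assume "is_reduction_of [1,1,1,1] [1,1,1,1] [2,2] [1,1,1,1] odd_box C"
  then have red: "odd_box i j 1 = reduction (replicate 4 1) (replicate 4 1) [2,2] (replicate 4 1) C i j 1"
    if "i \<in> {1..4}" "j \<in> {1..4}" for i j
    using that unfolding is_reduction_of_def replicate by simp
  \<comment> \<open>The two squares are the layers of \<open>C\<close> with third coordinate 1 and
    2, which together form the first block of \<open>[2,2]\<close>.\<close>
  show False
  proof (rule odd_layer_not_separable)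
    fix i j :: nat
    assume ij: "i \<in> {1..4}" "j \<in> {1..4}"
    have "odd_layer i j = set_mset (odd_box i j 1)"
      using ij unfolding atLeastAtMost_1_4 by (auto simp: odd_box_def odd_layer_def)
    also have "\<dots> = {C i j 1, C i j 2}"
      using set_mset_reduction_replicate_1[OF C ij, of "[2,2]" 1] red[OF ij] block by simp
    finally show "{C i j 1, C i j 2} = odd_layer i j" ..
  qed (use C in \<open>auto simp: latin_cube_def\<close>)
qed

theorem theorem7:
  shows "\<exists>(N::nat) P Q R S B.
           N > 0 \<and>
           is_partition N P \<and> is_partition N Q \<and> is_partition N R \<and> is_partition N S \<and>
           outline_box N P Q R S B \<and>
           \<not> (\<exists>C. latin_cube N C \<and> is_reduction_of P Q R S B C)"
proof -
  have "is_partition 4 [1,1,1,1]" "is_partition 4 [2,2]"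
    by (simp_all add: is_partition_def)
  then show ?thesis
    using outline_box_odd_box odd_box_not_reduction zero_less_numeral by blast
qed

end
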